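(* Let $A\in M_n(\mathbb{Z})$ be invertible such that $x\mapsto A^{-1}x$ is a similarity with respect to Euclidean distance, and let $D$ be a subset of a complete residue system mod $A$ such that every element of $T_{A,D-D}$ has a unique $(A,D-D)$-representation. Let $m\ge1$. Then for every $\lambda\in[0,\dim_B T_{A,D}]$, the level set $(\Theta^{(m)}_{A,D})^{-1}(\lambda)$ is dense in $F^{(m)}_{A,D}$.
   Context: A similarity means a map $f$ with $\|f(x)-f(y)\|=c\|x-y\|$ for some $c\in(0,1)$ and all $x,y$. For finite $E\subset\mathbb{R}^n$, $\pi_{A,E}((e_j)_{j\ge1})=\sum_{j\ge1}A^{-j}e_j$, $T_{A,E}=\pi_{A,E}(E^{\mathbb{N}})$, and an $(A,E)$-representation of $x$ is a sequence $(e_j)\in E^{\mathbb{N}}$ with $\pi_{A,E}((e_j))=x$. A complete residue system mod $A$ is a set $\mathcal{D}\subset\mathbb{Z}^n$ mapping bijectively onto $\mathbb{Z}^n/A\mathbb{Z}^n$. For $\vec\alpha=(\alpha^{(1)},\dots,\alpha^{(m)})\in(\mathbb{R}^n)^m$ write $T(\vec\alpha)=T_{A,D}\cap\bigcap_{i=1}^m(T_{A,D}+\alpha^{(i)})$. $F^{(m)}_{A,D}=\{\vec\alpha\in(T_{A,D-D})^m: T(\vec\alpha)\ne\emptyset\}$, and $\Theta^{(m)}_{A,D}$ is the function on $\{\vec\alpha\in F^{(m)}_{A,D}:\dim_B T(\vec\alpha)\text{ exists}\}$ given by $\Theta^{(m)}_{A,D}(\vec\alpha)=\dim_B T(\vec\alpha)$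 (box-counting dimension). *)

theory Defs
  imports "HOL-Analysis.Analysis"
begin

section \<open>Integer matrices and vectors, complete residue systems\<close>

definition int_vec :: "real^'n \<Rightarrow> bool" where
  "int_vec v \<longleftrightarrow> (\<forall>i. v $ i \<in> \<int>)"

definition int_mat :: "real^'n^'n \<Rightarrow> bool" where
  "int_mat A \<longleftrightarrow> (\<forall>i j. A $ i $ j \<in> \<int>)"

text \<open>A set of integer vectors mapping bijectively onto Z^n / A Z^n.\<close>
definition complete_residue_system :: "real^'n^'n \<Rightarrow> (real^'n) set \<Rightarrow> bool" where
  "complete_residue_system A R \<longleftrightarrow>
     (\<forall>d\<in>R. int_vec d) \<and>
     (\<forall>z. int_vec z \<longrightarrow> (\<exists>!d. d \<in> R \<and> (\<exists>w. int_vec w \<and> z - d = A *v w)))"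

section \<open>Similarities\<close>

definition is_similarity :: "(real^'n \<Rightarrow> real^'n) \<Rightarrow> bool" where
  "is_similarity f \<longleftrightarrow> (\<exists>c. 0 < c \<and> c < 1 \<and> (\<forall>x y. dist (f x) (f y) = c * dist x y))"

section \<open>Digit expansions\<close>

text \<open>A^{-j} x\<close>
definition Ainv_pow :: "real^'n^'n \<Rightarrow> nat \<Rightarrow> real^'n \<Rightarrow> real^'n" where
  "Ainv_pow A j x = (((*v) (matrix_inv A)) ^^ j) x"

text \<open>pi_{A,E}((e_j)_{j>=1}) = sum_{j>=1} A^{-j} e_j; the sequence is indexed from 0 here,
  so e 0 is the first digit e_1.\<close>
definition pi_AE :: "real^'n^'n \<Rightarrow> (nat \<Rightarrow> real^'n) \<Rightarrow> real^'n" where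
  "pi_AE A e = (\<Sum>j. Ainv_pow A (Suc j) (e j))"

definition T_set :: "real^'n^'n \<Rightarrow> (real^'n) set \<Rightarrow> (real^'n) set" where
  "T_set A E = {pi_AE A e | e. \<forall>j. e j \<in> E}"

definition is_rep :: "real^'n^'n \<Rightarrow> (real^'n) set \<Rightarrow> real^'n \<Rightarrow> (nat \<Rightarrow> real^'n) \<Rightarrow> bool" where
  "is_rep A E x e \<longleftrightarrow> (\<forall>j. e j \<in> E) \<and> pi_AE A e = x"

definition diff_set :: "(real^'n) set \<Rightarrow> (real^'n) set" where
  "diff_set D = {d1 - d2 | d1 d2. d1 \<in> D \<and> d2 \<in> D}"

section \<open>Box-counting dimension\<close>

text \<open>N_delta(F): smallest number of sets of diameter at most delta covering F (Falconer).\<close>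
definition cover_num :: "'a::metric_space set \<Rightarrow> real \<Rightarrow> nat" where
  "cover_num F \<delta> = (LEAST k. \<exists>C. finite C \<and> card C = k \<and> F \<subseteq> \<Union>C \<and>
                         (\<forall>S\<in>C. bounded S \<and> diameter S \<le> \<delta>))"

definition box_dim_exists :: "'a::metric_space set \<Rightarrow> bool" where
  "box_dim_exists F \<longleftrightarrow> F \<noteq> {} \<and> bounded F \<and>
     (\<exists>d. ((\<lambda>\<delta>. ln (real (cover_num F \<delta>)) / - ln \<delta>) \<longlongrightarrow> d) (at_right 0))"

definition box_dim :: "'a::metric_space set \<Rightarrow> real" where
  "box_dim F = (THE d. ((\<lambda>\<delta>. ln (real (cover_num F \<delta>)) / - ln \<delta>) \<longlongrightarrow> d) (at_right 0))"

section \<open>Intersections T(alpha), F^(m), level sets of Theta^(m)\<close>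

text \<open>vec alpha = (alpha_1,...,alpha_m) is represented as a function on nat, indices 1..m,
  with value 0 outside {1..m}.\<close>
definition T_inter :: "real^'n^'n \<Rightarrow> (real^'n) set \<Rightarrow> nat \<Rightarrow> (nat \<Rightarrow> real^'n) \<Rightarrow> (real^'n) set" where
  "T_inter A D m \<alpha> = T_set A D \<inter> (\<Inter>i\<in>{1..m}. (\<lambda>x. x + \<alpha> i) ` T_set A D)"

definition F_set :: "real^'n^'n \<Rightarrow> (real^'n) set \<Rightarrow> nat \<Rightarrow> (nat \<Rightarrow> real^'n) set" where
  "F_set A D m = {\<alpha>. (\<forall>i\<in>{1..m}. \<alpha> i \<in> T_set A (diff_set D)) \<and> (\<forall>i. i \<notin> {1..m} \<longrightarrow> \<alpha> i = 0)
                      \<and> T_inter A D m \<alpha> \<noteq> {}}"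

text \<open>(Theta^(m))^{-1}(lambda)\<close>
definition Theta_level :: "real^'n^'n \<Rightarrow> (real^'n) set \<Rightarrow> nat \<Rightarrow> real \<Rightarrow> (nat \<Rightarrow> real^'n) set" where
  "Theta_level A D m lam = {\<alpha> \<in> F_set A D m. box_dim_exists (T_inter A D m \<alpha>) \<and>
                                            box_dim (T_inter A D m \<alpha>) = lam}"

text \<open>Density of S in X inside (R^n)^m (coordinates 1..m).\<close>
definition dense_in_tuples :: "nat \<Rightarrow> (nat \<Rightarrow> real^'n) set \<Rightarrow> (nat \<Rightarrow> real^'n) set \<Rightarrow> bool" where
  "dense_in_tuples m S X \<longleftrightarrow>
     (\<forall>\<alpha>\<in>X. \<forall>\<epsilon>>0. \<exists>\<beta>\<in>S. \<forall>i\<in>{1..m}. dist (\<alpha> i) (\<beta> i) < \<epsilon>)"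

end

theory Submission
  imports Defs
begin

text \<open>
  By uniqueness of \<open>(A, D - D)\<close>-representations, \<open>T(\<alpha>)\<close> consists of the points whose \<open>j\<close>-th digit lies
  in \<open>D\<^sub>j = D \<inter> \<Inter>\<^sub>i (D + e\<^sup>i\<^sub>j)\<close>, where \<open>e\<^sup>i\<close> represents \<open>\<alpha>\<^sup>i\<close>. Scaling by \<open>A\<^sup>k\<close> turns
  the cylinders of level \<open>k\<close> into translates of a bounded set by distinct integer vectors, so at scale
  \<open>c\<^sup>k\<close> the covering number is, up to bounded factors, \<open>\<Prod>\<^sub>j\<^sub><\<^sub>k |D\<^sub>j|\<close>. Keeping the first digits of
  \<open>\<alpha>\<close> and choosing the later ones to be \<open>0\<close> (so that \<open>D\<^sub>j = D\<close>) on a set of indices of density \<open>\<theta>\<close>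
  and a longest vector of \<open>D - D\<close> (so that \<open>|D\<^sub>j| = 1\<close>) elsewhere gives every dimension
  \<open>\<theta> dim T\<close> with \<open>\<theta> \<in> [0, 1]\<close>, arbitrarily close to \<open>\<alpha>\<close>.
\<close>

section \<open>Integer vectors\<close>

lemma int_vec_0: "int_vec 0"
  by (simp add: int_vec_def)

lemma int_vec_add: "int_vec x \<Longrightarrow> int_vec y \<Longrightarrow> int_vec (x + y)"
  by (simp add: int_vec_def)

lemma int_vec_diff: "int_vec x \<Longrightarrow> int_vec y \<Longrightarrow> int_vec (x - y)"
  by (simp add: int_vec_def)

lemma int_vec_matrix_mult: "int_mat A \<Longrightarrow> int_vec x \<Longrightarrow> int_vec (A *v x)"
  by (auto simp: int_vec_def int_mat_def matrix_vector_mult_def intro!: Ints_sum Ints_mult)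

text \<open>Coordinatewise floors embed the set into the integer-valued functions on a bounded box,
  of which there are finitely many; on integer vectors taking floors loses nothing.\<close>

lemma finite_bounded_int_vec:
  fixes S :: "(real^'n) set"
  assumes "bounded S" and int: "\<And>z. z \<in> S \<Longrightarrow> int_vec z"
  shows "finite S"
proof -
  obtain b where b: "\<And>z. z \<in> S \<Longrightarrow> norm z \<le> b"
    using \<open>bounded S\<close> by (auto simp: bounded_iff)
  let ?h = "\<lambda>(z :: real^'n) i. \<lfloor>z $ i\<rfloor>"
  have "inj_on ?h S"
  proof (rule inj_onI)
    fix x y assume xy: "x \<in> S" "y \<in> S" "?h x = ?h y"
    have "x $ i = y $ i" for i
      using fun_cong[OF xy(3), of i] int[OF xy(1)] int[OF xy(2)]
      by (metis Ints_cases floor_of_int int_vec_def)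
    then show "x = y" by (simp add: vec_eq_iff)
  qed
  moreover have "?h ` S \<subseteq> Pi\<^sub>E UNIV (\<lambda>_. {-\<lceil>b\<rceil> - 1..\<lceil>b\<rceil>})"
  proof (safe intro!: PiE_I)
    fix z i assume "z \<in> S"
    then have "\<bar>z $ i\<bar> \<le> b"
      using b component_le_norm_cart order_trans by blast
    then show "\<lfloor>z $ i\<rfloor> \<in> {-\<lceil>b\<rceil> - 1..\<lceil>b\<rceil>}"
      by (simp add: abs_le_iff) linarith
  qed auto
  then have "finite (?h ` S)"
    by (rule finite_subset) (simp add: finite_PiE)
  ultimately show ?thesis
    by (rule finite_imageD[rotated])
qed

lemma matrix_inv_mult:
  fixes A :: "real^'n^'n"
  assumes "invertible A"
  shows "matrix_inv A *v (A *v x) = x" and "A *v (matrix_inv A *v x) = x"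
proof -
  have "A ** matrix_inv A = mat 1 \<and> matrix_inv A ** A = mat 1"
    using assms unfolding invertible_def matrix_inv_def by (rule someI_ex)
  then show "matrix_inv A *v (A *v x) = x" "A *v (matrix_inv A *v x) = x"
    by (simp_all add: matrix_vector_mul_assoc)
qed

text \<open>Subtracting \<open>A\<close> times the rounded-down \<open>matrix_inv A *v d\<close>
  moves each residue \<open>d\<close> within its class into the image under \<open>A\<close> of a
  bounded set. Distinct residues are incongruent, so this map is injective, and its values are
  bounded integer vectors.\<close>

lemma finite_complete_residue_system:
  fixes A :: "real^'n^'n"
  assumes A: "int_mat A" "invertible A" and R: "complete_residue_system A R"
  shows "finite R"
proof -
  define fl :: "real^'n \<Rightarrow> real^'n" where "fl x = (\<chi> i. of_int \<lfloor>x $ i\<rfloor>)" for x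
  define w where "w d = fl (matrix_inv A *v d)" for d
  define h where "h d = d - A *v w d" for d
  have int_w: "int_vec (w d)" for d
    by (simp add: w_def fl_def int_vec_def)
  have intR: "int_vec d" if "d \<in> R" for d
    using R that by (auto simp: complete_residue_system_def)
  have "inj_on h R"
  proof (rule inj_onI)
    fix x y assume xy: "x \<in> R" "y \<in> R" "h x = h y"
    then have "x - y = A *v (w x - w y)"
      by (simp add: h_def matrix_vector_mult_diff_distrib algebra_simps)
    \<comment> \<open>The second fact says that \<open>x\<close> represents its own class; the
      uniqueness of the representative of \<open>x\<close> then identifies \<open>y\<close> with
      \<open>x\<close>.\<close>
    moreover have "int_vec (w x - w y)" "x - x = A *v 0"
      using int_w int_vec_diff by auto
    ultimately show "x = y"
      using R intR[OF xy(1)] xy int_vec_0 unfolding complete_residue_system_def by metis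
  qed
  moreover have "finite (h ` R)"
  proof (rule finite_bounded_int_vec)
    have h: "h d = A *v (matrix_inv A *v d - w d)" for d
      using A(2) by (simp add: h_def matrix_vector_mult_diff_distrib matrix_inv_mult(2))
    have "norm (x - fl x) \<le> CARD('n)" for x :: "real^'n"
    proof -
      have "norm (x - fl x) \<le> (\<Sum>i\<in>UNIV. \<bar>(x - fl x) $ i\<bar>)"
        by (rule norm_le_l1_cart)
      also have "\<dots> \<le> (\<Sum>i\<in>(UNIV :: 'n set). 1)"
        by (rule sum_mono) (simp add: fl_def, linarith)
      finally show ?thesis by simp
    qed
    then have "bounded ((\<lambda>d. matrix_inv A *v d - w d) ` R)"
      by (auto simp: w_def bounded_iff)
    then have "bounded ((*v) A ` (\<lambda>d. matrix_inv A *v d - w d) ` R)"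
      by (rule bounded_linear_image) (rule matrix_vector_mul_bounded_linear)
    then show "bounded (h ` R)"
      by (simp add: image_image h)
    show "int_vec z" if "z \<in> h ` R" for z
      using that intR int_w A(1) by (auto simp: h_def intro!: int_vec_diff int_vec_matrix_mult)
  qed
  ultimately show ?thesis
    by (rule finite_imageD[rotated])
qed

section \<open>Digit expansions\<close>

locale contracting_matrix =
  fixes A :: "real^'n^'n" and c :: real
  assumes inv_A: "invertible A" and c_pos: "0 < c" and c_less_1: "c < 1"
    and norm_matrix_inv: "\<And>x. norm (matrix_inv A *v x) = c * norm x"
begin

lemma norm_Ainv_pow: "norm (Ainv_pow A k x) = c ^ k * norm x"
  by (induction k) (simp_all add: Ainv_pow_def norm_matrix_inv)

lemma linear_Ainv_pow: "linear (Ainv_pow A k)"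
  unfolding Ainv_pow_def
proof (induction k)
  case (Suc k)
  then have "linear ((*v) (matrix_inv A) \<circ> (\<lambda>x. ((*v) (matrix_inv A) ^^ k) x))"
    by (intro linear_compose) auto
  then show ?case by (simp add: o_def)
qed (simp add: linear_id[unfolded id_def])

lemma Ainv_pow_Suc': "Ainv_pow A (Suc k) x = Ainv_pow A k (matrix_inv A *v x)"
  by (simp add: Ainv_pow_def funpow_swap1)

lemma summable_majorant: "summable (\<lambda>j. c ^ Suc j * b)"
  using c_pos c_less_1 by (intro summable_mult2) simp

lemma summable_digits:
  assumes "\<And>j. norm (d j) \<le> b"
  shows "summable (\<lambda>j. Ainv_pow A (Suc j) (d j))"
proof (rule summable_comparison_test')
  show "norm (Ainv_pow A (Suc j) (d j)) \<le> c ^ Suc j * b" if "0 \<le> j" for j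
    unfolding norm_Ainv_pow using assms[of j] c_pos by (intro mult_left_mono) auto
qed (rule summable_majorant)

lemma norm_pi_AE_le:
  assumes "\<And>j. norm (d j) \<le> b"
  shows "norm (pi_AE A d) \<le> (\<Sum>j. c ^ Suc j * b)"
  unfolding pi_AE_def
proof (rule norm_suminf_le[OF _ summable_majorant])
  show "norm (Ainv_pow A (Suc j) (d j)) \<le> c ^ Suc j * b" for j
    unfolding norm_Ainv_pow using assms[of j] c_pos by (intro mult_left_mono) auto
qed

lemma pi_AE_diff:
  assumes "\<And>j. norm (d j) \<le> b" "\<And>j. norm (d' j) \<le> b'"
  shows "pi_AE A (\<lambda>j. d j - d' j) = pi_AE A d - pi_AE A d'"
  unfolding pi_AE_def linear_diff[OF linear_Ainv_pow]
  using suminf_diff[OF summable_digits[of d b] summable_digits[of d' b']] assms by simp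

lemma pi_AE_unfold:
  assumes "\<And>j. norm (d j) \<le> b"
  shows "pi_AE A d = matrix_inv A *v (d 0 + pi_AE A (\<lambda>j. d (Suc j)))"
proof -
  have S: "summable (\<lambda>j. Ainv_pow A (Suc j) (d (Suc j)))"
    using assms by (rule summable_digits)
  have "pi_AE A d = (\<Sum>j. Ainv_pow A (Suc (Suc j)) (d (Suc j))) + Ainv_pow A (Suc 0) (d 0)"
    unfolding pi_AE_def using suminf_split_head[OF summable_digits[of d b, OF assms]] by simp
  also have "(\<Sum>j. Ainv_pow A (Suc (Suc j)) (d (Suc j)))
      = (\<Sum>j. matrix_inv A *v Ainv_pow A (Suc j) (d (Suc j)))"
    by (simp add: Ainv_pow_def)
  also have "\<dots> = matrix_inv A *v pi_AE A (\<lambda>j. d (Suc j))"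
    unfolding pi_AE_def
    by (rule bounded_linear.suminf[OF matrix_vector_mul_bounded_linear S, symmetric])
  finally show ?thesis
    by (simp add: Ainv_pow_def matrix_vector_right_distrib)
qed

text \<open>\<open>A\<^sup>k\<close> times the \<open>k\<close>-th partial sum of the expansion.\<close>
primrec prefix_vec :: "nat \<Rightarrow> (nat \<Rightarrow> real^'n) \<Rightarrow> real^'n" where
  "prefix_vec 0 d = 0"
| "prefix_vec (Suc k) d = A *v prefix_vec k d + d k"

lemma prefix_vec_cong: "(\<And>j. j < k \<Longrightarrow> d j = d' j) \<Longrightarrow> prefix_vec k d = prefix_vec k d'"
  by (induction k) auto

text \<open>After scaling by \<open>A^k\<close> a point is its prefix vector plus a tail whose norm
  is bounded independently of \<open>k\<close>. For integer digits and integer \<open>A\<close> the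
  prefix vector is integral, which turns counting at scale \<open>c^k\<close> into counting lattice
  points.\<close>

lemma pi_AE_prefix:
  assumes "\<And>j. norm (d j) \<le> b"
  shows "pi_AE A d = Ainv_pow A k (prefix_vec k d + pi_AE A (\<lambda>j. d (j + k)))"
proof (induction k)
  case 0
  show ?case by (simp add: Ainv_pow_def)
next
  case (Suc k)
  have "prefix_vec k d = matrix_inv A *v (A *v prefix_vec k d)"
    by (simp add: matrix_inv_mult(1)[OF inv_A])
  moreover have "pi_AE A (\<lambda>j. d (j + k))
      = matrix_inv A *v (d k + pi_AE A (\<lambda>j. d (j + Suc k)))"
    using pi_AE_unfold[of "\<lambda>j. d (j + k)" b] assms by simp
  ultimately show ?case
    unfolding Suc Ainv_pow_Suc' by (simp add: matrix_vector_right_distrib algebra_simps)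
qed

text \<open>Only the tails differ, and each is bounded by the geometric sum. This bounds the
  diameter of a cylinder of level \<open>k\<close>.\<close>

lemma norm_pi_AE_diff_prefix:
  assumes "\<And>j. norm (d j) \<le> b" "\<And>j. norm (d' j) \<le> b"
    and "prefix_vec k d = prefix_vec k d'"
  shows "norm (pi_AE A d - pi_AE A d') \<le> c ^ k * (2 * (\<Sum>j. c ^ Suc j * b))"
proof -
  let ?s = "pi_AE A (\<lambda>j. d (j + k))" and ?s' = "pi_AE A (\<lambda>j. d' (j + k))"
  have "pi_AE A d - pi_AE A d' = Ainv_pow A k (?s - ?s')"
    using pi_AE_prefix[of d b k, OF assms(1)] pi_AE_prefix[of d' b k, OF assms(2)] assms(3)
    by (simp add: linear_diff[OF linear_Ainv_pow, symmetric])
  moreover have "norm (?s - ?s') \<le> 2 * (\<Sum>j. c ^ Suc j * b)"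
    using norm_pi_AE_le[of "\<lambda>j. d (j + k)" b] norm_pi_AE_le[of "\<lambda>j. d' (j + k)" b] assms
      norm_triangle_ineq4[of ?s ?s'] by simp
  ultimately show ?thesis
    using c_pos by (simp add: norm_Ainv_pow del: power_Suc)
qed

text \<open>Scaling by \<open>A^k\<close> brings the distance of the points to at most 1, and
  dropping the two tails costs one geometric sum each. The bound does not depend on
  \<open>k\<close>, so a set of diameter \<open>c^k\<close> meets boundedly many cylinders.\<close>

lemma prefix_vec_close:
  assumes "\<And>j. norm (d j) \<le> b" "\<And>j. norm (d' j) \<le> b"
    and "norm (pi_AE A d - pi_AE A d') \<le> c ^ k"
  shows "norm (prefix_vec k d - prefix_vec k d') \<le> 1 + 2 * (\<Sum>j. c ^ Suc j * b)"
proof -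
  let ?s = "pi_AE A (\<lambda>j. d (j + k))" and ?s' = "pi_AE A (\<lambda>j. d' (j + k))"
  let ?x = "prefix_vec k d + ?s - (prefix_vec k d' + ?s')"
  have "pi_AE A d - pi_AE A d' = Ainv_pow A k ?x"
    using pi_AE_prefix[of d b k, OF assms(1)] pi_AE_prefix[of d' b k, OF assms(2)]
    by (simp add: linear_diff[OF linear_Ainv_pow, symmetric])
  then have "norm ?x \<le> 1"
    using assms(3) c_pos by (simp add: norm_Ainv_pow)
  moreover have "norm ?s \<le> (\<Sum>j. c ^ Suc j * b)" "norm ?s' \<le> (\<Sum>j. c ^ Suc j * b)"
    by (intro norm_pi_AE_le assms)+
  moreover have eq: "prefix_vec k d - prefix_vec k d' = ?x - ?s + ?s'"
    by simp
  have "norm (prefix_vec k d - prefix_vec k d') \<le> norm ?x + norm ?s + norm ?s'"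
    unfolding eq using norm_triangle_ineq[of "?x - ?s" ?s'] norm_triangle_ineq4[of ?x ?s]
    by linarith
  ultimately show ?thesis by linarith
qed

end

section \<open>Box dimension of sets with prescribed digits\<close>

text \<open>The digit sets may vary with the position, because the intersections of translates
  impose a separate condition on each digit.\<close>

definition digit_product :: "real^'n^'n \<Rightarrow> (nat \<Rightarrow> (real^'n) set) \<Rightarrow> (real^'n) set" where
  "digit_product A G = {pi_AE A d | d. \<forall>j. d j \<in> G j}"

lemma T_set_eq_digit_product: "T_set A D = digit_product A (\<lambda>_. D)"
  by (simp add: T_set_def digit_product_def)

section \<open>Covering numbers and their logarithmic limits\<close>

lemma cover_num_le:
  assumes "finite C" "F \<subseteq> \<Union>C" "\<And>S. S \<in> C \<Longrightarrow> bounded S \<and> diameter S \<le> \<delta>"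
  shows "cover_num F \<delta> \<le> card C"
  unfolding cover_num_def by (rule Least_le) (use assms in blast)

text \<open>The minimum in \<open>cover_num\<close> is attained only if some finite cover exists;
  \<open>C\<close> supplies one.\<close>

lemma cover_num_attained:
  assumes "finite C" "F \<subseteq> \<Union>C" "\<And>S. S \<in> C \<Longrightarrow> bounded S \<and> diameter S \<le> \<delta>"
  obtains C' where "finite C'" "card C' = cover_num F \<delta>" "F \<subseteq> \<Union>C'"
    "\<And>S. S \<in> C' \<Longrightarrow> bounded S \<and> diameter S \<le> \<delta>"
proof -
  have "\<exists>C'. finite C' \<and> card C' = cover_num F \<delta> \<and> F \<subseteq> \<Union>C' \<and>
      (\<forall>S\<in>C'. bounded S \<and> diameter S \<le> \<delta>)"
    unfolding cover_num_def by (rule LeastI[of _ "card C"]) (use assms in blast)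
  then show ?thesis using that by blast
qed

lemma box_dimI:
  assumes "F \<noteq> {}" "bounded F"
    and lim: "((\<lambda>\<delta>. ln (real (cover_num F \<delta>)) / - ln \<delta>) \<longlongrightarrow> l) (at_right 0)"
  shows "box_dim_exists F" "box_dim F = l"
proof -
  show "box_dim_exists F"
    using assms by (auto simp: box_dim_exists_def)
  show "box_dim F = l"
    unfolding box_dim_def
    by (rule the_equality, rule lim) (rule tendsto_unique[OF trivial_limit_at_right_real _ lim])
qed

text \<open>Covering numbers need only be compared with \<open>N k\<close> along the geometric scales \<open>c\<^sup>k\<close>.\<close>
lemma tendsto_log_cover_num:
  fixes N :: "nat \<Rightarrow> nat" and V :: "real \<Rightarrow> nat"
  assumes c: "0 < c" "c < 1" and C: "C > 0" and M: "M > 0"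
    and N_pos: "\<And>k. N k > 0"
    and upper: "\<And>k \<delta>. 0 < \<delta> \<Longrightarrow> C * c ^ k \<le> \<delta> \<Longrightarrow> V \<delta> \<le> N k"
    and lower: "\<And>k \<delta>. 0 < \<delta> \<Longrightarrow> \<delta> \<le> c ^ k \<Longrightarrow> N k \<le> M * V \<delta>"
    and N_lim: "(\<lambda>k. ln (real (N k)) / real k) \<longlonglongrightarrow> L"
  shows "((\<lambda>\<delta>. ln (real (V \<delta>)) / - ln \<delta>) \<longlongrightarrow> L / - ln c) (at_right 0)"
proof -
  define r where "r = - ln c"
  have r: "r > 0" using c by (simp add: r_def)
  have pow: "c ^ k = exp (- r * real k)" for k
    using c by (simp add: r_def exp_of_nat_mult[symmetric] mult.commute[of _ "ln c"] exp_of_nat2_mult)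
  have s_lim: "filterlim (\<lambda>\<delta>. - ln \<delta>) at_top (at_right (0::real))"
    using ln_at_0 by (simp add: filterlim_uminus_at_top[symmetric] filterlim_uminus_at_bot)
  \<comment> \<open>Here \<open>s\<close> stands for \<open>- ln \<delta>\<close>, and
    \<open>k a s\<close> is the level at which \<open>c^k\<close> is comparable to
    \<open>\<delta> * exp (- a)\<close>. The shift \<open>a\<close> does not affect the limit of
    \<open>k a s / s\<close>.\<close>
  define k where "k a s = nat \<lfloor>(s + a) / r\<rfloor>" for a s
  have k_bounds: "real (k a s) \<le> (s + a) / r" "(s + a) / r < real (k a s) + 1"
    if "s + a \<ge> 0" for a s
    using that r by (simp_all add: k_def)
  have k_ratio: "((\<lambda>s. real (k a s) / s) \<longlongrightarrow> 1 / r) at_top" for a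
  proof (rule tendsto_sandwich)
    have ev: "eventually (\<lambda>s. s > 0 \<and> s + a \<ge> 0) at_top"
      using eventually_ge_at_top[of "max 1 (-a)"] by eventually_elim auto
    show "eventually (\<lambda>s. 1 / r + (a / r - 1) / s \<le> real (k a s) / s) at_top"
      using ev
    proof eventually_elim
      case (elim s)
      then have "(s + a) / r - 1 \<le> real (k a s)"
        using k_bounds(2)[of s a] by linarith
      then have "((s + a) / r - 1) / s \<le> real (k a s) / s"
        using elim by (intro divide_right_mono) auto
      then show ?case using elim r by (simp add: field_simps)
    qed
    show "eventually (\<lambda>s. real (k a s) / s \<le> 1 / r + (a / r) / s) at_top"
      using ev
    proof eventually_elim
      case (elim s)
      then have "real (k a s) / s \<le> ((s + a) / r) / s"
        using k_bounds(1)[of s a] by (intro divide_right_mono) auto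
      then show ?case using elim r by (simp add: field_simps)
    qed
    have *: "((\<lambda>s. 1 / r + b / s) \<longlongrightarrow> 1 / r) at_top" for b :: real
    proof -
      have "((\<lambda>s. 1 / r + b / s) \<longlongrightarrow> 1 / r + 0) at_top"
        by (intro tendsto_add tendsto_const tendsto_divide_0[OF tendsto_const]
            filterlim_at_top_imp_at_infinity filterlim_ident)
      then show ?thesis by simp
    qed
    show "((\<lambda>s. 1 / r + (a / r - 1) / s) \<longlongrightarrow> 1 / r) at_top"
      "((\<lambda>s. 1 / r + (a / r) / s) \<longlongrightarrow> 1 / r) at_top"
      by (rule *)+
  qed
  have k_top: "filterlim (k a) sequentially at_top" for a
    unfolding filterlim_at_top
  proof
    fix n :: nat
    show "eventually (\<lambda>s. n \<le> k a s) at_top"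
      using eventually_ge_at_top[of "r * real n - a"]
    proof eventually_elim
      case (elim s)
      then have "real n \<le> (s + a) / r" using r by (simp add: field_simps)
      then show ?case unfolding k_def by linarith
    qed
  qed
  have logN: "((\<lambda>s. ln (real (N (k a s))) / s) \<longlongrightarrow> L / r) at_top" for a
  proof -
    have "((\<lambda>s. ln (real (N (k a s))) / real (k a s) * (real (k a s) / s)) \<longlongrightarrow> L * (1 / r)) at_top"
      by (intro tendsto_mult k_ratio filterlim_compose[OF N_lim k_top])
    moreover have "eventually (\<lambda>s. ln (real (N (k a s))) / real (k a s) * (real (k a s) / s)
        = ln (real (N (k a s))) / s) at_top"
      using filterlim_at_top[THEN iffD1, OF k_top, rule_format, of 1 a]
      by eventually_elim simp
    ultimately have "((\<lambda>s. ln (real (N (k a s))) / s) \<longlongrightarrow> L * (1 / r)) at_top"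
      by (rule Lim_transform_eventually)
    then show ?thesis by simp
  qed
  have "((\<lambda>\<delta>. ln (real (V \<delta>)) / - ln \<delta>) \<longlongrightarrow> L / r) (at_right 0)"
  proof (rule tendsto_sandwich)
    \<comment> \<open>The summand \<open>ln C\<close> absorbs the factor \<open>C\<close>, and
      \<open>r\<close> makes up for the loss of less than one level in the floor. The condition in
      \<open>ev\<close> keeps the arguments of both floors nonnegative, where \<open>nat\<close>
      does not truncate.\<close>
    let ?a = "ln C + r"
    have ev: "eventually (\<lambda>\<delta>. \<delta> > 0 \<and> - ln \<delta> > max 0 (- ?a)) (at_right (0::real))"
      using eventually_at_right_less[of "0::real"]
        filterlim_at_top_dense[THEN iffD1, OF s_lim, rule_format, of "max 0 (- ?a)"]
      by eventually_elim blast
    have V_low: "N (k 0 (- ln \<delta>)) \<le> M * V \<delta>" if "\<delta> > 0" "- ln \<delta> > max 0 (- ?a)" for \<delta>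
    proof (rule lower)
      have "r * real (k 0 (- ln \<delta>)) \<le> - ln \<delta>"
        using k_bounds(1)[of "- ln \<delta>" 0] that r by (simp add: field_simps)
      then have "exp (ln \<delta>) \<le> exp (- r * real (k 0 (- ln \<delta>)))" by simp
      then show "\<delta> \<le> c ^ k 0 (- ln \<delta>)" using that by (simp add: pow)
    qed (use that in simp)
    have V_up: "V \<delta> \<le> N (k ?a (- ln \<delta>))" if "\<delta> > 0" "- ln \<delta> > max 0 (- ?a)" for \<delta>
    proof (rule upper)
      have "- ln \<delta> + ln C \<le> r * real (k ?a (- ln \<delta>))"
        using k_bounds(2)[of "- ln \<delta>" ?a] that r by (simp add: field_simps)
      then have "exp (ln C + - r * real (k ?a (- ln \<delta>))) \<le> exp (ln \<delta>)" by simp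
      then show "C * c ^ k ?a (- ln \<delta>) \<le> \<delta>" using that C by (simp add: pow exp_diff exp_minus divide_inverse)
    qed (use that in simp)
    show "eventually (\<lambda>\<delta>. ln (real (N (k 0 (- ln \<delta>)))) / - ln \<delta> - ln (real M) / - ln \<delta>
        \<le> ln (real (V \<delta>)) / - ln \<delta>) (at_right 0)"
      using ev
    proof eventually_elim
      case (elim \<delta>)
      have le: "N (k 0 (- ln \<delta>)) \<le> M * V \<delta>" using V_low elim by blast
      \<comment> \<open>Otherwise \<open>N\<close> would vanish at this level. Positivity is what
        allows the logarithms to be compared.\<close>
      then have "V \<delta> > 0" using N_pos[of "k 0 (- ln \<delta>)"] by (cases "V \<delta>") auto
      have "ln (real (N (k 0 (- ln \<delta>)))) \<le> ln (real (M * V \<delta>))"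
        using le M \<open>V \<delta> > 0\<close> N_pos[of "k 0 (- ln \<delta>)"] by (subst ln_le_cancel_iff) (auto simp del: of_nat_mult)
      also have "\<dots> = ln (real M) + ln (real (V \<delta>))"
        using M \<open>V \<delta> > 0\<close> by (simp add: ln_mult)
      finally have "ln (real (N (k 0 (- ln \<delta>)))) \<le> ln (real M) + ln (real (V \<delta>))" .
      then have "(ln (real (N (k 0 (- ln \<delta>)))) - ln (real M)) / - ln \<delta> \<le> ln (real (V \<delta>)) / - ln \<delta>"
        using elim by (intro divide_right_mono) auto
      then show ?case by (simp add: diff_divide_distrib)
    qed
    show "eventually (\<lambda>\<delta>. ln (real (V \<delta>)) / - ln \<delta>
        \<le> ln (real (N (k ?a (- ln \<delta>)))) / - ln \<delta>) (at_right 0)"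
      using ev
    proof eventually_elim
      case (elim \<delta>)
      have "V \<delta> > 0" using V_low[of \<delta>] elim N_pos[of "k 0 (- ln \<delta>)"] by (cases "V \<delta>") auto
      then have "ln (real (V \<delta>)) \<le> ln (real (N (k ?a (- ln \<delta>))))"
        using V_up[of \<delta>] elim N_pos[of "k ?a (- ln \<delta>)"] by (subst ln_le_cancel_iff) auto
      then show ?case using elim by (intro divide_right_mono) auto
    qed
    show "((\<lambda>\<delta>. ln (real (N (k ?a (- ln \<delta>)))) / - ln \<delta>) \<longlongrightarrow> L / r) (at_right 0)"
      by (rule filterlim_compose[OF logN s_lim])
    have "((\<lambda>\<delta>. ln (real (N (k 0 (- ln \<delta>)))) / - ln \<delta> - ln (real M) / - ln \<delta>)
        \<longlongrightarrow> L / r - 0) (at_right 0)"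
      by (intro tendsto_diff filterlim_compose[OF logN s_lim] tendsto_divide_0[OF tendsto_const]
          filterlim_at_top_imp_at_infinity s_lim)
    then show "((\<lambda>\<delta>. ln (real (N (k 0 (- ln \<delta>)))) / - ln \<delta> - ln (real M) / - ln \<delta>)
        \<longlongrightarrow> L / r) (at_right 0)" by simp
  qed
  then show ?thesis by (simp add: r_def)
qed

section \<open>Counting cylinders under unique representation\<close>

locale unique_difference_digits = contracting_matrix A c
  for A :: "real^'n^'n" and c :: real +
  fixes D :: "(real^'n) set"
  assumes int_A: "int_mat A" and finite_D: "finite D" and int_D: "\<And>d. d \<in> D \<Longrightarrow> int_vec d"
    and unique_rep: "\<And>x. x \<in> T_set A (diff_set D) \<Longrightarrow> \<exists>!e. is_rep A (diff_set D) x e"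
begin

lemma finite_diff_set: "finite (diff_set D)"
proof -
  have "diff_set D = (\<lambda>(x, y). x - y) ` (D \<times> D)" by (auto simp: diff_set_def)
  then show ?thesis using finite_D by simp
qed

lemma norm_bound: obtains b where "\<And>d. d \<in> D \<union> diff_set D \<Longrightarrow> norm d \<le> b"
  using finite_imp_bounded[of "D \<union> diff_set D"] finite_D finite_diff_set
  unfolding bounded_iff by auto

lemma diff_rep_unique:
  assumes "\<And>j. e j \<in> diff_set D" "\<And>j. e' j \<in> diff_set D" "pi_AE A e = pi_AE A e'"
  shows "e = e'"
proof -
  have "pi_AE A e \<in> T_set A (diff_set D)" using assms by (auto simp: T_set_def)
  from unique_rep[OF this] show ?thesis using assms by (auto simp: is_rep_def)
qed

text \<open>The digitwise difference of two expansions of one point expands 0 with digits in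
  \<open>diff_set D\<close>, and so does the zero sequence, written as \<open>d j - d j\<close> to
  exhibit it as a sequence of differences.\<close>

lemma rep_unique:
  assumes "\<And>j. d j \<in> D" "\<And>j. d' j \<in> D" "pi_AE A d = pi_AE A d'"
  shows "d = d'"
proof -
  obtain b where b: "\<And>d. d \<in> D \<union> diff_set D \<Longrightarrow> norm d \<le> b" by (rule norm_bound) blast
  have "pi_AE A (\<lambda>j. d j - d' j) = 0" "pi_AE A (\<lambda>j. d j - d j) = 0"
    using pi_AE_diff[of d b d' b] pi_AE_diff[of d b d b] assms b by simp_all
  then have "(\<lambda>j. d j - d' j) = (\<lambda>j. d j - d j)"
    using assms by (intro diff_rep_unique) (auto simp: diff_set_def)
  then show ?thesis by (auto simp: fun_eq_iff)
qed

lemma prefix_vec_inj: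
  assumes "\<And>j. j < k \<Longrightarrow> d j \<in> D" "\<And>j. j < k \<Longrightarrow> d' j \<in> D"
    and eq: "prefix_vec k d = prefix_vec k d'" and "j < k"
  shows "d j = d' j"
proof -
  obtain b where b: "\<And>d. d \<in> D \<union> diff_set D \<Longrightarrow> norm d \<le> b" by (rule norm_bound) blast
  \<comment> \<open>Both prefixes receive the same constant tail, so that equal prefix vectors give
    equal points. The digit \<open>d 0\<close> lies in \<open>D\<close> because \<open>j < k\<close>
    forces \<open>0 < k\<close>.\<close>
  define h where "h x j = (if j < k then x j else d 0)" for x :: "nat \<Rightarrow> real^'n" and j
  have h: "h d j \<in> D" "h d' j \<in> D" for j
    using assms by (auto simp: h_def)
  have "prefix_vec k (h d) = prefix_vec k (h d')"
    using eq prefix_vec_cong[of k "h d" d] prefix_vec_cong[of k "h d'" d'] by (simp add: h_def)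
  moreover have "(\<lambda>j. h d (j + k)) = (\<lambda>j. h d' (j + k))"
    by (simp add: h_def)
  ultimately have "pi_AE A (h d) = pi_AE A (h d')"
    using pi_AE_prefix[of "h d" b k] pi_AE_prefix[of "h d'" b k] h b by simp
  from rep_unique[OF h this] have "h d j = h d' j" by simp
  then show ?thesis using \<open>j < k\<close> by (simp add: h_def)
qed

lemma int_vec_prefix: "(\<And>j. j < k \<Longrightarrow> d j \<in> D) \<Longrightarrow> int_vec (prefix_vec k d)"
  by (induction k) (simp_all add: int_vec_0 int_vec_add int_vec_matrix_mult int_A int_D)

text \<open>This passes from infinite sequences to a finite product that can be counted; nonempty
  digit sets let every finite prefix be continued.\<close>

lemma prefix_vec_image:
  assumes "\<And>j. G j \<noteq> {}"
  shows "prefix_vec k ` {d. \<forall>j. d j \<in> G j} = prefix_vec k ` Pi\<^sub>E {..<k} G"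
proof (intro subset_antisym image_subsetI)
  fix d assume "d \<in> {d. \<forall>j. d j \<in> G j}"
  then have "restrict d {..<k} \<in> Pi\<^sub>E {..<k} G" by auto
  moreover have "prefix_vec k d = prefix_vec k (restrict d {..<k})"
    by (rule prefix_vec_cong) simp
  ultimately show "prefix_vec k d \<in> prefix_vec k ` Pi\<^sub>E {..<k} G" by blast
next
  fix d assume d: "d \<in> Pi\<^sub>E {..<k} G"
  define d' where "d' j = (if j < k then d j else SOME x. x \<in> G j)" for j
  have "d' \<in> {d. \<forall>j. d j \<in> G j}"
    using d assms by (auto simp: d'_def some_in_eq)
  moreover have "prefix_vec k d = prefix_vec k d'"
    by (rule prefix_vec_cong) (simp add: d'_def)
  ultimately show "prefix_vec k d \<in> prefix_vec k ` {d. \<forall>j. d j \<in> G j}" by blast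
qed

lemma card_prefix_vec:
  assumes "\<And>j. G j \<noteq> {}" "\<And>j. G j \<subseteq> D"
  shows "finite (prefix_vec k ` {d. \<forall>j. d j \<in> G j})"
    and "card (prefix_vec k ` {d. \<forall>j. d j \<in> G j}) = (\<Prod>j<k. card (G j))"
proof -
  have "finite (G j)" for j using assms(2) finite_D by (rule finite_subset)
  then show "finite (prefix_vec k ` {d. \<forall>j. d j \<in> G j})"
    unfolding prefix_vec_image[of G, OF assms(1)] by (auto intro: finite_PiE)
  have "inj_on (prefix_vec k) (Pi\<^sub>E {..<k} G)"
  proof (rule inj_onI)
    fix x y assume xy: "x \<in> Pi\<^sub>E {..<k} G" "y \<in> Pi\<^sub>E {..<k} G" "prefix_vec k x = prefix_vec k y"
    show "x = y"
    proof (rule PiE_ext[OF xy(1,2)])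
      fix j assume "j \<in> {..<k}"
      then show "x j = y j"
        using xy assms(2) by (intro prefix_vec_inj[of k x y]) (auto simp: PiE_iff)
    qed
  qed
  then show "card (prefix_vec k ` {d. \<forall>j. d j \<in> G j}) = (\<Prod>j<k. card (G j))"
    unfolding prefix_vec_image[of G, OF assms(1)] by (simp add: card_image card_PiE)
qed

text \<open>The cylinders of level \<open>k\<close> form a cover by sets of diameter comparable to
  \<open>c^k\<close>. Conversely, the prefixes occurring in a set of diameter at most
  \<open>c^k\<close> differ by integer vectors from a fixed ball, so each covering set accounts for
  at most \<open>M\<close> prefixes.\<close>

lemma cover_num_digit_product:
  assumes G: "\<And>j. G j \<noteq> {}" "\<And>j. G j \<subseteq> D"
  obtains C :: real and M :: nat where "C > 0" "M > 0"
    "\<And>k \<delta>. C * c ^ k \<le> \<delta> \<Longrightarrow> cover_num (digit_product A G) \<delta> \<le> (\<Prod>j<k. card (G j))"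
    "\<And>k \<delta>. 0 < \<delta> \<Longrightarrow> \<delta> \<le> c ^ k \<Longrightarrow>
        (\<Prod>j<k. card (G j)) \<le> M * cover_num (digit_product A G) \<delta>"
proof -
  obtain b where b: "\<And>d. d \<in> D \<union> diff_set D \<Longrightarrow> norm d \<le> b" by (rule norm_bound) blast
  define s where "s = (\<Sum>j. c ^ Suc j * b)"
  define P where "P = {d. \<forall>j. d j \<in> G j}"
  have P_norm: "norm (d j) \<le> b" if "d \<in> P" for d j
    using that b G(2) by (auto simp: P_def)
  have "(\<lambda>j. SOME x. x \<in> G j) \<in> P"
    using G(1) by (simp add: P_def some_in_eq)
  from norm_pi_AE_le[OF P_norm[OF this]] have s: "s \<ge> 0"
    unfolding s_def using norm_ge_zero order_trans by blast
  \<comment> \<open>\<open>2 * s\<close> bounds the diameter of a level \<open>k\<close> cylinder in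
    units of \<open>c^k\<close>; adding 1 keeps \<open>C\<close> positive when \<open>s = 0\<close>.
    The radius in \<open>W\<close> is the one from \<open>prefix_vec_close\<close>.\<close>
  define C where "C = 2 * s + 1"
  define W :: "(real^'n) set" where "W = {z. int_vec z \<and> norm z \<le> 1 + 2 * s}"
  have "bounded W"
    by (auto simp: W_def bounded_iff)
  then have W_fin: "finite W"
    by (rule finite_bounded_int_vec) (simp add: W_def)
  have "0 \<in> W" using s by (simp add: W_def int_vec_0)
  then have M: "card W > 0" using W_fin by (auto simp: card_gt_0_iff)
  have F: "digit_product A G = pi_AE A ` P"
    by (auto simp: digit_product_def P_def)
  define Z where "Z k = prefix_vec k ` P" for k
  have Z: "finite (Z k)" "card (Z k) = (\<Prod>j<k. card (G j))" for k
    unfolding Z_def P_def using card_prefix_vec[of G] G by auto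
  define cyl where "cyl k z = pi_AE A ` {d \<in> P. prefix_vec k d = z}" for k z
  have cyl_cover: "digit_product A G \<subseteq> \<Union>(cyl k ` Z k)" for k
    by (auto simp: F Z_def cyl_def)
  have cyl_dist: "norm (x - y) \<le> c ^ k * (2 * s)" if "x \<in> cyl k z" "y \<in> cyl k z" for x y k z
  proof -
    obtain d d' where "x = pi_AE A d" "y = pi_AE A d'" "d \<in> P" "d' \<in> P"
      "prefix_vec k d = prefix_vec k d'"
      using \<open>x \<in> cyl k z\<close> \<open>y \<in> cyl k z\<close> by (auto simp: cyl_def)
    then show ?thesis
      unfolding s_def using norm_pi_AE_diff_prefix[of d b d' k] P_norm by blast
  qed
  have cyl_small: "bounded S \<and> diameter S \<le> \<delta>" if k: "C * c ^ k \<le> \<delta>" and S: "S \<in> cyl k ` Z k" for S k \<delta>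
  proof -
    obtain z where z: "S = cyl k z" using S by blast
    have le: "c ^ k * (2 * s) \<le> \<delta>"
      using k c_pos unfolding C_def by (simp add: algebra_simps) (smt (verit) zero_less_power)
    have "bounded S"
      unfolding bounded_two_points z dist_norm using cyl_dist by blast
    moreover have "diameter S \<le> \<delta>"
    proof (rule diameter_le)
      show "S \<noteq> {} \<or> 0 \<le> \<delta>"
        using le s c_pos by (meson mult_nonneg_nonneg order_trans zero_le_power less_imp_le zero_le_numeral)
      show "norm (x - y) \<le> \<delta>" if "x \<in> S" "y \<in> S" for x y
        using cyl_dist that le z order_trans by blast
    qed
    ultimately show ?thesis by blast
  qed
  have upper: "cover_num (digit_product A G) \<delta> \<le> (\<Prod>j<k. card (G j))" if "C * c ^ k \<le> \<delta>" for k \<delta>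
  proof -
    have "cover_num (digit_product A G) \<delta> \<le> card (cyl k ` Z k)"
      using Z(1) cyl_cover cyl_small[OF that] by (intro cover_num_le) auto
    also have "\<dots> \<le> card (Z k)" using Z(1) by (rule card_image_le)
    finally show ?thesis by (simp add: Z(2))
  qed
  have lower: "(\<Prod>j<k. card (G j)) \<le> card W * cover_num (digit_product A G) \<delta>"
    if \<delta>: "0 < \<delta>" "\<delta> \<le> c ^ k" for k \<delta>
  proof -
    have "C > 0" using s by (simp add: C_def)
    \<comment> \<open>Cylinders of a sufficiently deep level \<open>l\<close>, unrelated to
      \<open>k\<close>, show that finite covers of mesh \<open>\<delta>\<close> exist, so an optimal
      one can be chosen.\<close>
    then obtain l where "c ^ l < \<delta> / C"
      using real_arch_pow_inv[of "\<delta> / C" c] \<delta> c_less_1 by auto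
    then have "C * c ^ l \<le> \<delta>" using \<open>C > 0\<close> by (simp add: field_simps)
    from cover_num_attained[of "cyl l ` Z l", OF _ cyl_cover cyl_small[OF this]] Z(1)
    obtain Cv where Cv: "finite Cv" "card Cv = cover_num (digit_product A G) \<delta>"
      "digit_product A G \<subseteq> \<Union>Cv" "\<And>S. S \<in> Cv \<Longrightarrow> bounded S \<and> diameter S \<le> \<delta>"
      by blast
    \<comment> \<open>The level \<open>k\<close> prefixes of points in \<open>S\<close>; relative to
      any one of them they lie in \<open>W\<close>.\<close>
    define fib where "fib S = prefix_vec k ` {d \<in> P. pi_AE A d \<in> S}" for S
    have fib_card: "card (fib S) \<le> card W" if "S \<in> Cv" for S
    proof (cases "fib S = {}")
      case False
      then obtain d where d: "d \<in> P" "pi_AE A d \<in> S" by (auto simp: fib_def)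
      have "fib S \<subseteq> (\<lambda>w. w + prefix_vec k d) ` W"
      proof
        fix z assume "z \<in> fib S"
        then obtain d' where d': "z = prefix_vec k d'" "d' \<in> P" "pi_AE A d' \<in> S"
          by (auto simp: fib_def)
        have "norm (pi_AE A d' - pi_AE A d) \<le> diameter S"
          using diameter_bounded_bound[of S] Cv(4)[OF that] d d' by (simp add: dist_norm[symmetric])
        then have "norm (pi_AE A d' - pi_AE A d) \<le> c ^ k"
          using Cv(4)[OF that] \<delta> by linarith
        then have "norm (z - prefix_vec k d) \<le> 1 + 2 * s"
          unfolding d'(1) s_def using P_norm d d' by (intro prefix_vec_close) auto
        moreover have "int_vec (z - prefix_vec k d)"
          using d d' G(2) by (auto intro!: int_vec_diff int_vec_prefix simp: P_def)
        ultimately have "z - prefix_vec k d \<in> W" by (simp add: W_def)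
        then show "z \<in> (\<lambda>w. w + prefix_vec k d) ` W"
          by (metis diff_add_cancel image_eqI)
      qed
      then show ?thesis using W_fin by (meson card_image_le card_mono finite_imageI order_trans)
    qed simp
    have "Z k = (\<Union>S\<in>Cv. fib S)"
      using Cv(3) by (auto simp: Z_def fib_def F)
    then have "card (Z k) \<le> (\<Sum>S\<in>Cv. card (fib S))"
      using card_UN_le[OF Cv(1)] by simp
    also have "\<dots> \<le> (\<Sum>S\<in>Cv. card W)" by (rule sum_mono) (rule fib_card)
    finally show ?thesis by (simp add: Z(2) Cv(2) mult.commute)
  qed
  show thesis
    by (rule that[of C "card W"]) (use s M upper lower in \<open>auto simp: C_def\<close>)
qed

lemma box_dim_digit_product:
  assumes G: "\<And>j. G j \<noteq> {}" "\<And>j. G j \<subseteq> D"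
    and lim: "(\<lambda>k. ln (real (\<Prod>j<k. card (G j))) / real k) \<longlonglongrightarrow> L"
  shows "box_dim_exists (digit_product A G)" and "box_dim (digit_product A G) = L / - ln c"
proof -
  obtain b where b: "\<And>d. d \<in> D \<union> diff_set D \<Longrightarrow> norm d \<le> b" by (rule norm_bound) blast
  obtain C :: real and M :: nat where CM: "C > 0" "M > 0"
    "\<And>k \<delta>. C * c ^ k \<le> \<delta> \<Longrightarrow> cover_num (digit_product A G) \<delta> \<le> (\<Prod>j<k. card (G j))"
    "\<And>k \<delta>. 0 < \<delta> \<Longrightarrow> \<delta> \<le> c ^ k \<Longrightarrow>
        (\<Prod>j<k. card (G j)) \<le> M * cover_num (digit_product A G) \<delta>"
    using cover_num_digit_product[of G] G by blast
  have fin: "finite (G j)" for j using G(2) finite_D by (rule finite_subset)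
  have pos: "(\<Prod>j<k. card (G j)) > 0" for k
    using G(1) fin by (intro prod_pos) (simp add: card_gt_0_iff)
  have L: "((\<lambda>\<delta>. ln (real (cover_num (digit_product A G) \<delta>)) / - ln \<delta>) \<longlongrightarrow> L / - ln c) (at_right 0)"
    by (rule tendsto_log_cover_num[OF c_pos c_less_1 CM(1,2) pos CM(3,4) lim])
  have bd: "bounded (digit_product A G)"
    unfolding bounded_iff
  proof (intro exI ballI)
    fix x assume "x \<in> digit_product A G"
    then obtain d where d: "x = pi_AE A d" "\<And>j. d j \<in> G j" by (auto simp: digit_product_def)
    show "norm x \<le> (\<Sum>j. c ^ Suc j * b)"
      unfolding d(1) using d(2) G(2) b by (intro norm_pi_AE_le) blast
  qed
  have "\<forall>j. (SOME x. x \<in> G j) \<in> G j"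
    using G(1) by (simp add: some_in_eq)
  then have ne: "digit_product A G \<noteq> {}"
    by (auto simp: digit_product_def)
  show "box_dim_exists (digit_product A G)" and "box_dim (digit_product A G) = L / - ln c"
    by (rule box_dimI[OF ne bd L])+
qed

section \<open>Intersections of translates\<close>

text \<open>If \<open>x\<close> lies in both \<open>T\<close> and its translate by
  \<open>\<alpha> i\<close>, subtracting the two digit sequences gives an expansion of
  \<open>\<alpha> i\<close>, which by uniqueness is \<open>e i\<close>. Membership therefore
  decouples into conditions on single digits; conversely, subtracting \<open>e i\<close> digitwise
  gives the point of \<open>T\<close> to be translated.\<close>

lemma T_inter_eq_digit_product:
  assumes e: "\<And>i j. i \<in> {1..m} \<Longrightarrow> e i j \<in> diff_set D"
    and \<alpha>: "\<And>i. i \<in> {1..m} \<Longrightarrow> \<alpha> i = pi_AE A (e i)"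
  shows "T_inter A D m \<alpha> = digit_product A (\<lambda>j. {x \<in> D. \<forall>i\<in>{1..m}. x - e i j \<in> D})"
    (is "_ = digit_product A ?G")
proof (intro subset_antisym subsetI)
  obtain b where b: "\<And>d. d \<in> D \<union> diff_set D \<Longrightarrow> norm d \<le> b" by (rule norm_bound) blast
  {
    fix x assume x: "x \<in> T_inter A D m \<alpha>"
    then obtain d where d: "x = pi_AE A d" "\<And>j. d j \<in> D"
      by (auto simp: T_inter_def T_set_def)
    have "d j - e i j \<in> D" if i: "i \<in> {1..m}" for i j
    proof -
      from x i obtain d' where d': "x = pi_AE A d' + \<alpha> i" "\<And>j. d' j \<in> D"
        by (fastforce simp: T_inter_def T_set_def)
      have "pi_AE A (\<lambda>j. d j - d' j) = pi_AE A (e i)"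
        using pi_AE_diff[of d b d' b] d d' b \<alpha>[OF i] by (metis UnI1 add_diff_cancel_left')
      then have "(\<lambda>j. d j - d' j) = e i"
        using d d' e[OF i] by (intro diff_rep_unique) (auto simp: diff_set_def)
      then have "d j - d' j = e i j" by (rule fun_cong)
      then have "d j - e i j = d' j" by (simp add: algebra_simps)
      then show ?thesis using d'(2) by simp
    qed
    then show "x \<in> digit_product A ?G"
      using d by (auto simp: digit_product_def)
  next
    fix x assume "x \<in> digit_product A ?G"
    then obtain d where d: "x = pi_AE A d" "\<And>j. d j \<in> D"
      "\<And>i j. i \<in> {1..m} \<Longrightarrow> d j - e i j \<in> D"
      by (auto simp: digit_product_def)
    have "x \<in> (\<lambda>y. y + \<alpha> i) ` T_set A D" if i: "i \<in> {1..m}" for i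
    proof
      show "x = pi_AE A (\<lambda>j. d j - e i j) + \<alpha> i"
        using pi_AE_diff[of d b "e i" b] d(1,2) b \<alpha>[OF i] e[OF i] by simp
      show "pi_AE A (\<lambda>j. d j - e i j) \<in> T_set A D"
        using d(3)[OF i] by (auto simp: T_set_def)
    qed
    then show "x \<in> T_inter A D m \<alpha>"
      using d by (auto simp: T_inter_def T_set_def)
  }
qed

end

text \<open>A longest difference \<open>u = a - b\<close> is realised only once: if also \<open>u = x - y\<close>, then
  \<open>(a - y) + (x - b) = 2 u\<close> with both summands no longer than \<open>u\<close>, so both equal \<open>u\<close>.\<close>
lemma longest_difference_unique:
  fixes D :: "(real^'n) set"
  assumes "finite D" "D \<noteq> {}"
  obtains u a where "u \<in> diff_set D" "{x \<in> D. x - u \<in> D} = {a}"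
proof -
  have "finite (D \<times> D)" "D \<times> D \<noteq> {}" using assms by auto
  then obtain p where p: "is_arg_min (\<lambda>(x, y). - norm (x - y)) (\<lambda>p. p \<in> D \<times> D) p"
    using ex_is_arg_min_if_finite by blast
  obtain a b where ab: "p = (a, b)" by (cases p)
  have D: "a \<in> D" "b \<in> D" and max: "\<And>x y. x \<in> D \<Longrightarrow> y \<in> D \<Longrightarrow> norm (x - y) \<le> norm (a - b)"
    using p unfolding ab is_arg_min_linorder by auto
  have "x = a" if "x \<in> D" "x - (a - b) \<in> D" for x
  proof -
    define u v where "u = a - b" and "v = x - b"
    have "norm v \<le> norm u" "norm (2 *\<^sub>R u - v) \<le> norm u"
      using max[OF that(1) D(2)] max[OF D(1) that(2)] by (simp_all add: u_def v_def scaleR_2 algebra_simps)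
    then have "v \<bullet> v \<le> u \<bullet> u" "(2 *\<^sub>R u - v) \<bullet> (2 *\<^sub>R u - v) \<le> u \<bullet> u"
      by (simp_all add: norm_le)
    \<comment> \<open>Parallelogram law: the squared norms of \<open>v\<close> and
      \<open>2 u - v\<close> add up to twice those of \<open>u\<close> and
      \<open>v - u\<close>.\<close>
    then have "(v - u) \<bullet> (v - u) \<le> 0"
      by (simp add: inner_diff_left inner_diff_right inner_commute algebra_simps)
    then have "v = u" using inner_ge_zero[of "v - u"] by (metis antisym eq_iff_diff_eq_0 inner_eq_zero_iff)
    then show ?thesis by (simp add: u_def v_def)
  qed
  then show thesis
    using D by (intro that[of "a - b" a]) (auto simp: diff_set_def)
qed

section \<open>Digit positions of prescribed density\<close>

lemma tendsto_floor_mult_div: "(\<lambda>k. real_of_int \<lfloor>real k * \<theta>\<rfloor> / real k) \<longlonglongrightarrow> \<theta>"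
proof (rule tendsto_sandwich)
  show "eventually (\<lambda>k. \<theta> - 1 / real k \<le> real_of_int \<lfloor>real k * \<theta>\<rfloor> / real k) sequentially"
    using eventually_gt_at_top[of 0]
  proof eventually_elim
    case (elim k)
    have "real k * \<theta> - 1 \<le> real_of_int \<lfloor>real k * \<theta>\<rfloor>" by linarith
    then have "(real k * \<theta> - 1) / real k \<le> real_of_int \<lfloor>real k * \<theta>\<rfloor> / real k"
      by (rule divide_right_mono) simp
    then show ?case using elim by (simp add: diff_divide_distrib)
  qed
  show "eventually (\<lambda>k. real_of_int \<lfloor>real k * \<theta>\<rfloor> / real k \<le> \<theta>) sequentially"
    using eventually_gt_at_top[of 0]
  proof eventually_elim
    case (elim k)
    have "real_of_int \<lfloor>real k * \<theta>\<rfloor> \<le> real k * \<theta>" by linarith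
    then show ?case using elim by (simp add: field_simps)
  qed
  have "(\<lambda>k. \<theta> - 1 / real k) \<longlonglongrightarrow> \<theta> - 0"
    by (intro tendsto_diff tendsto_const lim_1_over_n)
  then show "(\<lambda>k. \<theta> - 1 / real k) \<longlonglongrightarrow> \<theta>" by simp
qed simp

text \<open>The indices at which \<open>\<lfloor>j \<theta>\<rfloor>\<close> jumps form a set of density \<open>\<theta>\<close>.\<close>
lemma tendsto_log_prod_density:
  fixes g :: "nat \<Rightarrow> nat"
  assumes \<theta>: "0 \<le> \<theta>" "\<theta> \<le> 1" and q: "q > 0" and pos: "\<And>j. g j > 0"
    and g: "\<And>j. j \<ge> K \<Longrightarrow> g j = (if \<lfloor>real (Suc j) * \<theta>\<rfloor> > \<lfloor>real j * \<theta>\<rfloor> then q else 1)"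
  shows "(\<lambda>k. ln (real (\<Prod>j<k. g j)) / real k) \<longlonglongrightarrow> \<theta> * ln (real q)"
proof -
  let ?P = "\<lambda>k. ln (real (\<Prod>j<k. g j))" and ?f = "\<lambda>k. real_of_int \<lfloor>real k * \<theta>\<rfloor>"
  have jump: "\<lfloor>real (Suc j) * \<theta>\<rfloor> = \<lfloor>real j * \<theta>\<rfloor> \<or> \<lfloor>real (Suc j) * \<theta>\<rfloor> = \<lfloor>real j * \<theta>\<rfloor> + 1" for j
  proof -
    have "real (Suc j) * \<theta> = real j * \<theta> + \<theta>" by (simp add: algebra_simps)
    then have "real j * \<theta> \<le> real (Suc j) * \<theta>" "real (Suc j) * \<theta> \<le> real j * \<theta> + 1"
      using \<theta> by auto
    then have "\<lfloor>real j * \<theta>\<rfloor> \<le> \<lfloor>real (Suc j) * \<theta>\<rfloor>" "\<lfloor>real (Suc j) * \<theta>\<rfloor> \<le> \<lfloor>real j * \<theta> + 1\<rfloor>"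
      by (simp_all only: floor_mono)
    then show ?thesis unfolding one_add_floor[symmetric] by linarith
  qed
  \<comment> \<open>Each jump of the floor is by exactly one and contributes one factor
    \<open>q\<close>, so the logarithm telescopes from \<open>K\<close> on. The first
    \<open>K\<close> factors contribute a constant, which vanishes after division by
    \<open>k\<close>.\<close>
  have P: "?P k = ?P K + (?f k - ?f K) * ln (real q)" if "k \<ge> K" for k
    using that
  proof (induction k rule: dec_induct)
    case (step k)
    have "?P (Suc k) = ?P k + ln (real (g k))"
      using pos by (simp add: ln_mult prod_pos del: of_nat_prod)
    also have "ln (real (g k)) = (?f (Suc k) - ?f k) * ln (real q)"
      using g[OF step.hyps(1)] jump[of k] by auto
    finally show ?case using step.IH by (simp add: algebra_simps)
  qed simp
  have "(\<lambda>k. (?P K - ?f K * ln (real q)) / real k + ?f k / real k * ln (real q))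
      \<longlonglongrightarrow> 0 + \<theta> * ln (real q)"
    by (intro tendsto_add tendsto_mult tendsto_const tendsto_floor_mult_div lim_const_over_n)
  moreover have "eventually (\<lambda>k. (?P K - ?f K * ln (real q)) / real k + ?f k / real k * ln (real q)
      = ?P k / real k) sequentially"
    using eventually_ge_at_top[of K]
  proof eventually_elim
    case (elim k)
    show ?case unfolding P[OF elim] by (simp add: add_divide_distrib diff_divide_distrib algebra_simps)
  qed
  ultimately have "(\<lambda>k. ?P k / real k) \<longlonglongrightarrow> 0 + \<theta> * ln (real q)"
    by (rule Lim_transform_eventually)
  then show ?thesis by simp
qed

section \<open>Nearby translation vectors with prescribed dimension\<close>

context unique_difference_digits
begin

lemma box_dim_T_set:
  assumes "D \<noteq> {}"
  shows "box_dim (T_set A D) = ln (real (card D)) / - ln c"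
proof -
  have "card D > 0" using assms finite_D by (simp add: card_gt_0_iff)
  \<comment> \<open>The case of density 1, where the floor jumps at every index.\<close>
  then have "(\<lambda>k. ln (real (\<Prod>j<k. card D)) / real k) \<longlonglongrightarrow> 1 * ln (real (card D))"
    by (intro tendsto_log_prod_density[where K = 0]) (auto simp: floor_add_int[symmetric])
  then show ?thesis
    unfolding T_set_eq_digit_product using assms by (intro box_dim_digit_product) auto
qed

lemma exists_near_with_box_dim:
  assumes m: "m \<ge> 1" and lam: "0 \<le> lam" "lam \<le> box_dim (T_set A D)"
    and \<alpha>: "\<alpha> \<in> F_set A D m" and \<epsilon>: "\<epsilon> > 0"
  obtains \<beta> where "\<beta> \<in> Theta_level A D m lam" "\<And>i. i \<in> {1..m} \<Longrightarrow> dist (\<alpha> i) (\<beta> i) < \<epsilon>"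
proof -
  obtain b where b: "\<And>d. d \<in> D \<union> diff_set D \<Longrightarrow> norm d \<le> b" by (rule norm_bound) blast
  have D: "D \<noteq> {}"
    using \<alpha> by (auto simp: F_set_def T_inter_def T_set_def)
  have "\<forall>i\<in>{1..m}. \<exists>e. (\<forall>j. e j \<in> diff_set D) \<and> \<alpha> i = pi_AE A e"
    using \<alpha> by (auto simp: F_set_def T_set_def)
  then obtain e where e: "\<And>i j. i \<in> {1..m} \<Longrightarrow> e i j \<in> diff_set D"
    "\<And>i. i \<in> {1..m} \<Longrightarrow> \<alpha> i = pi_AE A (e i)"
    by metis
  obtain u a where u: "u \<in> diff_set D" "{x \<in> D. x - u \<in> D} = {a}"
    using longest_difference_unique[OF finite_D D] by blast
  define r where "r = - ln c"
  have r: "r > 0" using c_pos c_less_1 by (simp add: r_def)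
  define q where "q = card D"
  have q: "q > 0" using D finite_D by (simp add: q_def card_gt_0_iff)
  \<comment> \<open>If \<open>q = 1\<close>, then \<open>lam = 0\<close> and the division by zero yields the right value \<open>\<theta> = 0\<close>.\<close>
  define \<theta> where "\<theta> = lam * r / ln (real q)"
  have lam_le: "lam * r \<le> ln (real q)"
    using lam(2) r unfolding box_dim_T_set[OF D] q_def r_def[symmetric] by (simp add: field_simps)
  have \<theta>: "0 \<le> \<theta>" "\<theta> \<le> 1" "\<theta> * ln (real q) = lam * r"
  proof -
    have "ln (real q) \<ge> 0" using q by simp
    then show "0 \<le> \<theta>" "\<theta> \<le> 1"
      using lam lam_le r by (auto simp: \<theta>_def divide_le_eq_1)
    show "\<theta> * ln (real q) = lam * r"
      using lam lam_le r by (cases "ln (real q) = 0") (auto simp: \<theta>_def zero_le_mult_iff mult_le_0_iff)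
  qed
  define s where "s = (\<Sum>j. c ^ Suc j * b)"
  \<comment> \<open>Changing digits only from position \<open>K\<close> on moves a point by at most
    \<open>c ^ K * (2 * s)\<close>.\<close>
  obtain K where K: "c ^ K * (2 * s) < \<epsilon>"
  proof -
    have "(\<lambda>k. c ^ k * (2 * s)) \<longlonglongrightarrow> 0 * (2 * s)"
      using c_pos c_less_1 by (intro tendsto_mult tendsto_const LIMSEQ_realpow_zero) auto
    then have "eventually (\<lambda>k. c ^ k * (2 * s) < \<epsilon>) sequentially"
      using order_tendstoD(2) \<epsilon> by fastforce
    then show thesis using that by (auto simp: eventually_sequentially)
  qed
  \<comment> \<open>The tail is the same for every \<open>i\<close>, so the \<open>m\<close>
    translates impose one common condition on each late digit and their intersection cannot become
    empty there.\<close>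
  define e' where "e' i j = (if j < K then e i j
      else if \<lfloor>real (Suc j) * \<theta>\<rfloor> > \<lfloor>real j * \<theta>\<rfloor> then 0 else u)" for i j
  define \<beta> where "\<beta> i = (if i \<in> {1..m} then pi_AE A (e' i) else 0)" for i
  define G where "G x j = {y \<in> D. \<forall>i\<in>{1..m}. y - x i j \<in> D}" for x :: "nat \<Rightarrow> nat \<Rightarrow> real^'n" and j
  have "0 \<in> diff_set D" using D by (auto simp: diff_set_def)
  then have e'D: "e' i j \<in> diff_set D" if "i \<in> {1..m}" for i j
    using e(1)[OF that] u by (simp add: e'_def)
  have T\<alpha>: "T_inter A D m \<alpha> = digit_product A (G e)"
    unfolding G_def by (rule T_inter_eq_digit_product) (use e in auto)
  have T\<beta>: "T_inter A D m \<beta> = digit_product A (G e')"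
    unfolding G_def by (rule T_inter_eq_digit_product) (use e'D in \<open>auto simp: \<beta>_def\<close>)
  have G_tail: "G e' j = (if \<lfloor>real (Suc j) * \<theta>\<rfloor> > \<lfloor>real j * \<theta>\<rfloor> then D else {a})" if "j \<ge> K" for j
  proof -
    \<comment> \<open>With at least one translate present, the condition given by \<open>u\<close>
      really occurs and cuts the digit set down to \<open>{a}\<close>.\<close>
    have "{1..m} \<noteq> {}" using m by simp
    then have "G e' j = {x \<in> D. x - u \<in> D}" if "\<not> \<lfloor>real (Suc j) * \<theta>\<rfloor> > \<lfloor>real j * \<theta>\<rfloor>"
      using that \<open>j \<ge> K\<close> unfolding G_def e'_def by auto
    then show ?thesis
      using that u(2) by (auto simp: G_def e'_def)
  qed
  \<comment> \<open>The first \<open>K\<close> digit sets are those of \<open>\<alpha>\<close>, and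
    they are nonempty because \<open>T(\<alpha>)\<close> is.\<close>
  have "digit_product A (G e) \<noteq> {}"
    using \<alpha> T\<alpha> by (simp add: F_set_def)
  then have "G e j \<noteq> {}" for j
    by (auto simp: digit_product_def)
  then have G_ne: "G e' j \<noteq> {}" for j
    using G_tail[of j] D by (cases "j < K") (auto simp: G_def e'_def)
  have G_D: "G e' j \<subseteq> D" for j by (auto simp: G_def)
  have "finite (G e' j)" for j using G_D finite_D by (rule finite_subset)
  then have "card (G e' j) > 0" for j using G_ne by (simp add: card_gt_0_iff)
  then have "(\<lambda>k. ln (real (\<Prod>j<k. card (G e' j))) / real k) \<longlonglongrightarrow> \<theta> * ln (real q)"
    using \<theta> q G_tail by (intro tendsto_log_prod_density[where K = K]) (auto simp: q_def)
  from box_dim_digit_product[OF G_ne G_D this]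
  have dim: "box_dim_exists (T_inter A D m \<beta>)" "box_dim (T_inter A D m \<beta>) = lam"
    using r by (simp_all add: T\<beta> \<theta>(3) r_def)
  \<comment> \<open>Nonemptiness of the intersection is part of
    \<open>box_dim_exists\<close>.\<close>
  have "\<beta> \<in> F_set A D m"
    using dim(1) e'D by (auto simp: F_set_def \<beta>_def T_set_def box_dim_exists_def)
  then have "\<beta> \<in> Theta_level A D m lam"
    using dim by (simp add: Theta_level_def)
  moreover have "dist (\<alpha> i) (\<beta> i) < \<epsilon>" if i: "i \<in> {1..m}" for i
  proof -
    have "prefix_vec K (e i) = prefix_vec K (e' i)"
      by (rule prefix_vec_cong) (simp add: e'_def)
    then have "norm (pi_AE A (e i) - pi_AE A (e' i)) \<le> c ^ K * (2 * s)"
      unfolding s_def using e(1)[OF i] e'D[OF i] b by (intro norm_pi_AE_diff_prefix) auto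
    then show ?thesis
      using K e(2)[OF i] i by (simp add: \<beta>_def dist_norm)
  qed
  ultimately show thesis by (rule that)
qed

end

theorem mainTheorem13:
  fixes A :: "real^'n^'n" and D :: "(real^'n) set" and m :: nat and lam :: real
  assumes "int_mat A" and "invertible A"
    and "is_similarity (\<lambda>x. matrix_inv A *v x)"
    and "\<exists>R. complete_residue_system A R \<and> D \<subseteq> R"
    and "\<forall>x\<in>T_set A (diff_set D). \<exists>!e. is_rep A (diff_set D) x e"
    and "m \<ge> 1"
    and "lam \<in> {0..box_dim (T_set A D)}"
  shows "dense_in_tuples m (Theta_level A D m lam) (F_set A D m)"
proof -
  obtain c where c: "0 < c" "c < 1"
    and dist: "\<And>x y. dist (matrix_inv A *v x) (matrix_inv A *v y) = c * dist x y"
    using assms(3) unfolding is_similarity_def by blast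
  have norm: "norm (matrix_inv A *v x) = c * norm x" for x
    using dist[of x 0] by simp
  obtain R where R: "complete_residue_system A R" "D \<subseteq> R"
    using assms(4) by blast
  interpret unique_difference_digits A c D
  proof
    show "finite D"
      using finite_complete_residue_system[OF assms(1,2) R(1)] R(2) finite_subset by blast
    show "int_vec d" if "d \<in> D" for d
      using R that by (auto simp: complete_residue_system_def)
  qed (use assms c norm in auto)
  show ?thesis
    unfolding dense_in_tuples_def
  proof (intro ballI allI impI)
    fix \<alpha> and \<epsilon> :: real assume "\<alpha> \<in> F_set A D m" "\<epsilon> > 0"
    with assms(6,7) obtain \<beta> where "\<beta> \<in> Theta_level A D m lam"
      "\<And>i. i \<in> {1..m} \<Longrightarrow> dist (\<alpha> i) (\<beta> i) < \<epsilon>"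
      using exists_near_with_box_dim[of m lam \<alpha> \<epsilon>] by auto
    then show "\<exists>\<beta>\<in>Theta_level A D m lam. \<forall>i\<in>{1..m}. dist (\<alpha> i) (\<beta> i) < \<epsilon>" by blast
  qed
qed

end
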